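(* Let $u_1,\ldots,u_n,v_1,\ldots,v_n\in\mathcal{M}$. Then $\phi(u_1)\otimes\cdots\otimes\phi(u_n)=\phi(v_1)\otimes\cdots\otimes\phi(v_n)$ in $\mathcal{W}^{\otimes n}$ if and only if $\phi(u_i)=\phi(v_i)$ for each $i\in\{1,\ldots,n\}$.
   Context: $\Bbbk$ is a field of characteristic $0$; $\mathcal{M}$ is the free monoid on letters $D,U$; $\mathcal{W}=\Bbbk\langle D,U\mid DU-UD=1\rangle$ is the Weyl algebra; $\phi:\mathcal{M}\to\mathcal{W}$ is the monoid morphism $D\mapsto D,U\mapsto U$; tensor products are over $\Bbbk$. *)

theory Defs
  imports
    Complex_Main
    "HOL-Library.Poly_Mapping"
    "HOL-Library.FuncSet"
begin

section \<open>The free monoid and the free algebra on \<open>D\<close> and \<open>U\<close>\<close>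

datatype letter = D | U

text \<open>The free monoid \<open>\<M>\<close>: words under concatenation.\<close>

type_synonym word = "letter list"

text \<open>
  Multiplication of finitely supported functions is convolution over an additively written monoid
  of exponents. With concatenation as that addition, \<open>word \<Rightarrow>\<^sub>0 'k\<close> is the monoid
  algebra of the free monoid, i.e. the free algebra on the two letters.
\<close>

instantiation list :: (type) monoid_add
begin

definition zero_list :: "'a list" where "zero_list = []"

definition plus_list :: "'a list \<Rightarrow> 'a list \<Rightarrow> 'a list" where "plus_list = (@)"

instance by standard (simp_all add: zero_list_def plus_list_def)

end

type_synonym 'k free_alg = "word \<Rightarrow>\<^sub>0 'k"

definition mon :: "word \<Rightarrow> 'k::field free_alg"
  where "mon w = Poly_Mapping.single w 1"

lemma mon_Nil: "mon [] = 1"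
  by (metis mon_def zero_list_def single_one)

lemma mon_append: "mon (u @ v) = mon u * mon v"
  by (simp add: mon_def mult_single plus_list_def)


section \<open>The Weyl algebra\<close>

text \<open>The two-sided ideal generated by \<open>DU - UD - 1\<close>.\<close>

inductive_set weyl_ideal :: "'k::field free_alg set" where
  generator: "mon [D] * mon [U] - mon [U] * mon [D] - 1 \<in> weyl_ideal"
| zero: "0 \<in> weyl_ideal"
| add: "p \<in> weyl_ideal \<Longrightarrow> q \<in> weyl_ideal \<Longrightarrow> p + q \<in> weyl_ideal"
| mult_left: "p \<in> weyl_ideal \<Longrightarrow> r * p \<in> weyl_ideal"
| mult_right: "p \<in> weyl_ideal \<Longrightarrow> p * r \<in> weyl_ideal"

lemma weyl_ideal_uminus: "p \<in> weyl_ideal \<Longrightarrow> - p \<in> weyl_ideal"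
  using weyl_ideal.mult_left[of p "- 1"] by simp

lemma weyl_ideal_diff: "p \<in> weyl_ideal \<Longrightarrow> q \<in> weyl_ideal \<Longrightarrow> p - q \<in> weyl_ideal"
  using weyl_ideal.add[of p "- q"] weyl_ideal_uminus[of q] by simp

definition weyl_rel :: "'k::field free_alg \<Rightarrow> 'k free_alg \<Rightarrow> bool"
  where "weyl_rel p q \<longleftrightarrow> p - q \<in> weyl_ideal"

lemma equivp_weyl_rel: "equivp (weyl_rel :: 'k::field free_alg \<Rightarrow> _)"
proof (rule equivpI)
  let ?R = "weyl_rel :: 'k free_alg \<Rightarrow> _"
  show "reflp ?R"
    by (rule reflpI) (simp add: weyl_rel_def weyl_ideal.zero)
  show "symp ?R"
  proof (rule sympI)
    fix p q :: "'k free_alg" assume "weyl_rel p q"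
    then show "weyl_rel q p"
      using weyl_ideal_uminus[of "p - q"] by (simp add: weyl_rel_def)
  qed
  show "transp ?R"
  proof (rule transpI)
    fix p q r :: "'k free_alg" assume "weyl_rel p q" "weyl_rel q r"
    then show "weyl_rel p r"
      using weyl_ideal.add[of "p - q" "q - r"] by (simp add: weyl_rel_def)
  qed
qed

quotient_type (overloaded) 'k weyl = "'k::field free_alg" / weyl_rel
  by (rule equivp_weyl_rel)

instantiation weyl :: (field) ring
begin

lift_definition zero_weyl :: "'a weyl" is 0 .

lift_definition plus_weyl :: "'a weyl \<Rightarrow> 'a weyl \<Rightarrow> 'a weyl" is "(+)"
proof -
  fix p p' q q' :: "'a free_alg"
  assume "weyl_rel p p'" "weyl_rel q q'"
  then show "weyl_rel (p + q) (p' + q')"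
    using weyl_ideal.add[of "p - p'" "q - q'"] by (simp add: weyl_rel_def algebra_simps)
qed

lift_definition uminus_weyl :: "'a weyl \<Rightarrow> 'a weyl" is uminus
proof -
  fix p p' :: "'a free_alg"
  assume "weyl_rel p p'"
  then show "weyl_rel (- p) (- p')"
    using weyl_ideal_uminus[of "p - p'"] by (simp add: weyl_rel_def)
qed

lift_definition minus_weyl :: "'a weyl \<Rightarrow> 'a weyl \<Rightarrow> 'a weyl" is "(-)"
proof -
  fix p p' q q' :: "'a free_alg"
  assume "weyl_rel p p'" "weyl_rel q q'"
  then show "weyl_rel (p - q) (p' - q')"
    using weyl_ideal_diff[of "p - p'" "q - q'"] by (simp add: weyl_rel_def algebra_simps)
qed

lift_definition times_weyl :: "'a weyl \<Rightarrow> 'a weyl \<Rightarrow> 'a weyl" is "(*)"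
proof -
  fix p p' q q' :: "'a free_alg"
  assume rel: "weyl_rel p p'" "weyl_rel q q'"
  have "p * q - p' * q' = (p - p') * q + p' * (q - q')"
    by (simp add: algebra_simps)
  moreover have "(p - p') * q + p' * (q - q') \<in> weyl_ideal"
    using rel unfolding weyl_rel_def
    by (intro weyl_ideal.add weyl_ideal.mult_left weyl_ideal.mult_right)
  ultimately show "weyl_rel (p * q) (p' * q')"
    by (simp add: weyl_rel_def)
qed

instance
  by standard
    (transfer; simp add: algebra_simps equivp_reflp[OF equivp_weyl_rel])+

end

text \<open>
  The library class of unital rings additionally postulates \<open>0 \<noteq> 1\<close>, which is a theorem about
  the quotient rather than part of its construction; \<open>monoid_mult\<close> supplies the unit laws.
\<close>

instantiation weyl :: (field) monoid_mult
begin

lift_definition one_weyl :: "'a weyl" is 1 .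

instance
  by standard
    (transfer; simp add: equivp_reflp[OF equivp_weyl_rel])+

end

lift_definition weyl_scale :: "'k::field \<Rightarrow> 'k weyl \<Rightarrow> 'k weyl"
  is "\<lambda>c. Poly_Mapping.map ((*) c)"
proof -
  fix c :: 'k and p q :: "'k free_alg"
  assume "weyl_rel p q"
  then show "weyl_rel (Poly_Mapping.map ((*) c) p) (Poly_Mapping.map ((*) c) q)"
    using weyl_ideal.mult_left[of "p - q" "Poly_Mapping.single 0 c"]
    by (simp add: weyl_rel_def mult_map_scale_conv_mult right_diff_distrib)
qed

lemma vector_space_weyl: "vector_space (weyl_scale :: 'k::field \<Rightarrow> 'k weyl \<Rightarrow> 'k weyl)"
proof
  fix a b :: 'k and x y :: "'k weyl"
  note simps = mult_map_scale_conv_mult algebra_simps equivp_reflp[OF equivp_weyl_rel]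
  show "weyl_scale a (x + y) = weyl_scale a x + weyl_scale a y"
    by transfer (simp add: simps)
  show "weyl_scale (a + b) x = weyl_scale a x + weyl_scale b x"
    by transfer (simp add: simps single_add)
  show "weyl_scale a (weyl_scale b x) = weyl_scale (a * b) x"
    by transfer (simp add: simps mult_single flip: mult.assoc)
  show "weyl_scale 1 x = x"
    by transfer (simp add: simps)
qed

lemma weyl_scale_mult:
  fixes c :: "'k::field"
  shows "weyl_scale c (x * y) = weyl_scale c x * y"
    and "weyl_scale c (x * y) = x * weyl_scale c y"
proof -
  show "weyl_scale c (x * y) = weyl_scale c x * y"
    by transfer
      (simp add: mult_map_scale_conv_mult mult.assoc equivp_reflp[OF equivp_weyl_rel])
  have central: "Poly_Mapping.single 0 c * p = p * Poly_Mapping.single 0 c"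
    for c :: 'k and p :: "'k free_alg"
  proof (induction p rule: update_induct)
    case const
    show ?case by simp
  next
    case (update f a b)
    then have "Poly_Mapping.update a b f = Poly_Mapping.single a b + f"
      by (intro poly_mapping_eqI)
        (auto simp: lookup_update lookup_add lookup_single in_keys_iff when_def)
    with update show ?case by (simp add: distrib_left distrib_right mult_single mult.commute[of b c])
  qed
  have swap: "Poly_Mapping.single 0 c * (p * q) = p * (Poly_Mapping.single 0 c * q)"
    for c :: 'k and p q :: "'k free_alg"
    using central[of c p] by (simp flip: mult.assoc)
  show "weyl_scale c (x * y) = x * weyl_scale c y"
    by transfer
      (simp add: mult_map_scale_conv_mult swap equivp_reflp[OF equivp_weyl_rel])
qed

lift_definition weyl_gen :: "letter \<Rightarrow> 'k::field weyl" is "\<lambda>l. mon [l]" .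

lemma weyl_commutator: "weyl_gen D * weyl_gen U - weyl_gen U * weyl_gen D = 1"
  by transfer (simp add: weyl_rel_def weyl_ideal.generator)

text \<open>The monoid morphism \<open>\<phi>\<close> from the free monoid to the Weyl algebra extending
  \<open>D \<mapsto> D\<close>, \<open>U \<mapsto> U\<close>.\<close>

definition phi :: "word \<Rightarrow> 'k::field weyl"
  where "phi w = prod_list (map weyl_gen w)"

lemma phi_Nil: "phi [] = 1"
  and phi_single: "phi [l] = weyl_gen l"
  and phi_append: "phi (u @ v) = phi u * phi v"
  by (simp_all add: phi_def)


section \<open>Tensor powers\<close>

abbreviation free_scale :: "'k::field \<Rightarrow> ('b \<Rightarrow>\<^sub>0 'k) \<Rightarrow> ('b \<Rightarrow>\<^sub>0 'k)"
  where "free_scale c \<equiv> Poly_Mapping.map ((*) c)"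

lemma lookup_free_scale: "Poly_Mapping.lookup (free_scale c p) b = c * Poly_Mapping.lookup p b"
  by (simp add: map.rep_eq when_def)

lemma vector_space_free: "vector_space (free_scale :: 'k::field \<Rightarrow> ('b \<Rightarrow>\<^sub>0 'k) \<Rightarrow> _)"
  by standard
    (rule poly_mapping_eqI; simp add: lookup_free_scale lookup_add algebra_simps)+

text \<open>
  The tensor power \<open>V\<^sup>\<otimes>\<^sup>I\<close> of a vector space \<open>V\<close> with scalar multiplication \<open>s\<close> is the quotient of the
  free vector space on the \<open>I\<close>-tuples of vectors by the relations making the tuple multilinear in
  each slot. Tuples are functions that are \<open>undefined\<close> off \<open>I\<close>; elements of the quotient are cosets.
\<close>

definition tuple_space :: "'i set \<Rightarrow> (('i \<Rightarrow> 'v) \<Rightarrow>\<^sub>0 'k::field) set"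
  where "tuple_space I = {p. Poly_Mapping.keys p \<subseteq> extensional I}"

inductive_set tensor_relators ::
    "('k::field \<Rightarrow> 'v::ab_group_add \<Rightarrow> 'v) \<Rightarrow> 'i set \<Rightarrow> (('i \<Rightarrow> 'v) \<Rightarrow>\<^sub>0 'k) set"
  for s :: "'k \<Rightarrow> 'v \<Rightarrow> 'v" and I :: "'i set" where
  add: "f \<in> extensional I \<Longrightarrow> i \<in> I \<Longrightarrow>
    Poly_Mapping.single (f(i := x + y)) 1
      - Poly_Mapping.single (f(i := x)) 1 - Poly_Mapping.single (f(i := y)) 1
    \<in> tensor_relators s I"
| scale: "f \<in> extensional I \<Longrightarrow> i \<in> I \<Longrightarrow>
    Poly_Mapping.single (f(i := s c x)) 1 - free_scale c (Poly_Mapping.single (f(i := x)) 1)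
    \<in> tensor_relators s I"

definition tensor_rel ::
    "('k::field \<Rightarrow> 'v::ab_group_add \<Rightarrow> 'v) \<Rightarrow> 'i set
      \<Rightarrow> ((('i \<Rightarrow> 'v) \<Rightarrow>\<^sub>0 'k) \<times> (('i \<Rightarrow> 'v) \<Rightarrow>\<^sub>0 'k)) set"
  where "tensor_rel s I =
    {(p, q). p \<in> tuple_space I \<and> q \<in> tuple_space I \<and>
             p - q \<in> module.span free_scale (tensor_relators s I)}"

definition tensor_power ::
    "('k::field \<Rightarrow> 'v::ab_group_add \<Rightarrow> 'v) \<Rightarrow> 'i set \<Rightarrow> (('i \<Rightarrow> 'v) \<Rightarrow>\<^sub>0 'k) set set"
  where "tensor_power s I = tuple_space I // tensor_rel s I"

definition pure_tensor ::
    "('k::field \<Rightarrow> 'v::ab_group_add \<Rightarrow> 'v) \<Rightarrow> 'i set \<Rightarrow> ('i \<Rightarrow> 'v) \<Rightarrow> (('i \<Rightarrow> 'v) \<Rightarrow>\<^sub>0 'k) set"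
  where "pure_tensor s I f = tensor_rel s I `` {Poly_Mapping.single (restrict f I) 1}"

lemma equiv_tensor_rel:
  fixes s :: "'k::field \<Rightarrow> 'v::ab_group_add \<Rightarrow> 'v" and I :: "'i set"
  shows "equiv (tuple_space I) (tensor_rel s I)"
proof (rule equivI)
  interpret F: vector_space "free_scale :: 'k \<Rightarrow> (('i \<Rightarrow> 'v) \<Rightarrow>\<^sub>0 'k) \<Rightarrow> _"
    by (rule vector_space_free)
  let ?R = "tensor_rel s I"
  show "?R \<subseteq> tuple_space I \<times> tuple_space I"
    by (auto simp: tensor_rel_def)
  show "refl_on (tuple_space I) ?R"
    by (auto simp: refl_on_def tensor_rel_def F.span_zero)
  show "sym ?R"
  proof (rule symI)
    fix p q assume "(p, q) \<in> ?R"
    then show "(q, p) \<in> ?R"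
      using F.span_neg[of "p - q"] by (simp add: tensor_rel_def)
  qed
  show "trans ?R"
  proof (rule transI)
    fix p q r assume "(p, q) \<in> ?R" "(q, r) \<in> ?R"
    then show "(p, r) \<in> ?R"
      using F.span_add[of "p - q" _ "q - r"] by (simp add: tensor_rel_def)
  qed
qed

lemma pure_tensor_in_tensor_power: "pure_tensor s I f \<in> tensor_power s I"
  by (auto simp: pure_tensor_def tensor_power_def tuple_space_def intro!: quotientI)

lemma pure_tensor_eq_iff:
  "pure_tensor s I f = pure_tensor s I g \<longleftrightarrow>
    Poly_Mapping.single (restrict f I) 1 - Poly_Mapping.single (restrict g I) 1
      \<in> module.span free_scale (tensor_relators s I)"
  unfolding pure_tensor_def
  by (subst eq_equiv_class_iff[OF equiv_tensor_rel]) (auto simp: tensor_rel_def tuple_space_def)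

end

theory Submission
  imports Defs "HOL-Computational_Algebra.Polynomial"
begin

text \<open>
  Let \<open>D\<close> and \<open>U\<close> act on \<open>K[x]\<close> by \<open>f \<mapsto> f + f'\<close> and \<open>f \<mapsto> x f\<close>, i.e. as differentiation and
  multiplication by \<open>x\<close> on \<open>K[x] e\<^sup>x\<close>. Both maps send monic polynomials to monic polynomials, so
  applying an element of the Weyl algebra to \<open>1\<close> is a linear map \<open>\<W> \<rightarrow> K[x]\<close> that takes a monic
  value at every \<open>\<phi>(w)\<close>. Contracting all tensor slots but the \<open>j\<close>-th with coefficients of this map
  that equal \<open>1\<close> at \<open>\<phi>(u\<^sub>i)\<close> yields \<open>\<phi>(u\<^sub>j) = c \<phi>(v\<^sub>j)\<close> for a scalar \<open>c\<close>, and comparing leading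
  coefficients of the images in \<open>K[x]\<close> forces \<open>c = 1\<close>.
\<close>

text \<open>The universal property of the free vector space on \<open>'b\<close>; the basis
  \<open>'b\<close> is later taken to be tuples (for tensor powers) and words (for the free
  algebra).\<close>

definition lin_ext :: "('k \<Rightarrow> 'w \<Rightarrow> 'w) \<Rightarrow> ('b \<Rightarrow> 'w) \<Rightarrow> ('b \<Rightarrow>\<^sub>0 'k::field) \<Rightarrow> 'w::ab_group_add"
  where "lin_ext t m p = (\<Sum>b\<in>Poly_Mapping.keys p. t (Poly_Mapping.lookup p b) (m b))"

context vector_space
begin

lemma lin_ext_single: "lin_ext scale m (Poly_Mapping.single b c) = scale c (m b)"
  by (simp add: lin_ext_def)

lemma linear_lin_ext: "Vector_Spaces.linear free_scale scale (lin_ext scale m)"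
proof -
  \<comment> \<open>Cancellation can shrink supports, so sums are compared over a common finite
    superset.\<close>
  have superset: "lin_ext scale m p = (\<Sum>b\<in>A. scale (Poly_Mapping.lookup p b) (m b))"
    if "finite A" "Poly_Mapping.keys p \<subseteq> A" for p A
    unfolding lin_ext_def using that
    by (intro sum.mono_neutral_left) (auto simp: in_keys_iff)
  have add: "lin_ext scale m (p + q) = lin_ext scale m p + lin_ext scale m q" for p q
    using superset[of "Poly_Mapping.keys p \<union> Poly_Mapping.keys q"]
    by (simp add: keys_add lookup_add scale_left_distrib sum.distrib)
  have scl: "lin_ext scale m (free_scale c p) = scale c (lin_ext scale m p)" for c p
  proof -
    have "Poly_Mapping.keys (free_scale c p) \<subseteq> Poly_Mapping.keys p"
      by (auto simp: lookup_free_scale in_keys_iff)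
    from superset[OF finite_keys this] show ?thesis
      by (simp add: lookup_free_scale lin_ext_def scale_sum_right)
  qed
  interpret F: vector_space "free_scale :: 'a \<Rightarrow> ('c \<Rightarrow>\<^sub>0 'a) \<Rightarrow> _"
    by (rule vector_space_free)
  show ?thesis
    by unfold_locales (fact add scl)+
qed

text \<open>Universal property of the tensor power: the linear extension of a multilinear
  \<open>m\<close> kills every relator, hence their span.\<close>

lemma pure_tensor_eqD:
  assumes eq: "pure_tensor s I f = pure_tensor s I g"
    and add: "\<And>h i x y. h \<in> extensional I \<Longrightarrow> i \<in> I \<Longrightarrow>
      m (h(i := x + y)) = m (h(i := x)) + m (h(i := y))"
    and scale: "\<And>h i c x. h \<in> extensional I \<Longrightarrow> i \<in> I \<Longrightarrow>
      m (h(i := s c x)) = scale c (m (h(i := x)))"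
  shows "m (restrict f I) = m (restrict g I)"
proof -
  interpret L: Vector_Spaces.linear free_scale scale "lin_ext scale m"
    by (rule linear_lin_ext)
  have "lin_ext scale m r = 0" if "r \<in> tensor_relators s I" for r
    using that
    by cases (simp_all add: L.diff L.scale lin_ext_single add scale)
  then have "lin_ext scale m
      (Poly_Mapping.single (restrict f I) 1 - Poly_Mapping.single (restrict g I) 1) = 0"
    using eq unfolding pure_tensor_eq_iff by (rule L.eq_0_on_span)
  then show ?thesis
    by (simp add: L.diff lin_ext_single)
qed

end

text \<open>Scaling \<open>h j\<close> by the product of the other \<open>l i (h i)\<close> is
  multilinear in \<open>h\<close>, so the result depends only on the pure tensor.\<close>

lemma pure_tensor_eq_contract:
  fixes s :: "'k::field \<Rightarrow> 'v::ab_group_add \<Rightarrow> 'v"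
  assumes "vector_space s" and eq: "pure_tensor s I f = pure_tensor s I g"
    and fin: "finite I" and j: "j \<in> I"
    and l: "\<And>i. i \<in> I \<Longrightarrow> Vector_Spaces.linear s (*) (l i)"
  shows "s (\<Prod>i\<in>I - {j}. l i (f i)) (f j) = s (\<Prod>i\<in>I - {j}. l i (g i)) (g j)"
proof -
  interpret vector_space s by fact
  define m where "m h = s (\<Prod>i\<in>I - {j}. l i (h i)) (h j)" for h
  \<comment> \<open>Isolates the updated slot: it enters either as the vector being scaled or as a
    single factor of the scalar.\<close>
  have m_upd: "m (h(i := x)) = (if i = j then s (\<Prod>i\<in>I - {j}. l i (h i)) x
      else s (l i x * (\<Prod>i\<in>I - {j} - {i}. l i (h i))) (h j))" if "i \<in> I" for h i x
  proof (cases "i = j")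
    case False
    then have "(\<Prod>k\<in>I - {j}. l k ((h(i := x)) k)) = l i x * (\<Prod>k\<in>I - {j} - {i}. l k (h k))"
      using fin that by (subst prod.remove[of _ i]) (auto intro!: prod.cong)
    with False show ?thesis by (simp add: m_def)
  next
    case True
    then have "(\<Prod>k\<in>I - {j}. l k ((h(i := x)) k)) = (\<Prod>k\<in>I - {j}. l k (h k))"
      by (intro prod.cong) auto
    with True show ?thesis by (simp add: m_def)
  qed
  have "m (restrict f I) = m (restrict g I)"
  proof (rule pure_tensor_eqD[OF eq])
    fix h i x y assume "i \<in> I"
    then interpret li: Vector_Spaces.linear s "(*)" "l i" by (rule l)
    show "m (h(i := x + y)) = m (h(i := x)) + m (h(i := y))"
      using \<open>i \<in> I\<close>
      by (simp add: m_upd li.add scale_right_distrib distrib_right scale_left_distrib)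
  next
    fix h i c x assume "i \<in> I"
    then interpret li: Vector_Spaces.linear s "(*)" "l i" by (rule l)
    show "m (h(i := s c x)) = s c (m (h(i := x)))"
      using \<open>i \<in> I\<close> by (cases "i = j") (simp_all add: m_upd li.scale mult.commute[of c])
  qed
  with j show ?thesis
    by (simp add: m_def)
qed

text \<open>The summand \<open>f\<close> keeps \<open>D\<close> from annihilating \<open>1\<close>,
  as plain differentiation would, and leaves the commutator with multiplication by \<open>x\<close>
  equal to the identity.\<close>

fun letter_op :: "letter \<Rightarrow> 'k::field poly \<Rightarrow> 'k poly"
  where
    "letter_op D f = f + pderiv f"
  | "letter_op U f = pCons 0 f"

interpretation poly_vs: vector_space "smult :: 'k::field \<Rightarrow> _"
  by standard (simp_all add: smult_add_right smult_add_left)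

definition alg_op :: "'k::field free_alg \<Rightarrow> 'k poly \<Rightarrow> 'k poly"
  where "alg_op p f = lin_ext smult (\<lambda>w. foldr letter_op w f) p"

interpretation alg_op: Vector_Spaces.linear free_scale smult "\<lambda>p. alg_op p f"
  for f :: "'k::field poly"
  unfolding alg_op_def by (rule poly_vs.linear_lin_ext)

lemma alg_op_single: "alg_op (Poly_Mapping.single w c) f = smult c (foldr letter_op w f)"
  by (simp add: alg_op_def poly_vs.lin_ext_single)

lemma letter_op_add: "letter_op a (f + g) = letter_op a f + letter_op a g"
  by (cases a) (simp_all add: pderiv_add)

lemma letter_op_smult: "letter_op a (smult c f) = smult c (letter_op a f)"
  by (cases a) (simp_all add: pderiv_smult smult_add_right)

lemma word_op_add: "foldr letter_op w (f + g) = foldr letter_op w f + foldr letter_op w g"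
  by (induction w) (simp_all add: letter_op_add)

lemma word_op_smult: "foldr letter_op w (smult c f) = smult c (foldr letter_op w f)"
  by (induction w) (simp_all add: letter_op_smult)

lemma free_alg_induct [case_names zero single_add]:
  assumes "P 0" and "\<And>w c p. P p \<Longrightarrow> P (Poly_Mapping.single w c + p)"
  shows "P (p :: 'b \<Rightarrow>\<^sub>0 'a::comm_monoid_add)"
proof (induction p rule: update_induct)
  case (update f a b)
  then have "Poly_Mapping.update a b f = Poly_Mapping.single a b + f"
    by (intro poly_mapping_eqI)
      (auto simp: lookup_update lookup_add lookup_single in_keys_iff when_def)
  with update assms show ?case by simp
qed (fact assms)

lemma alg_op_add_right: "alg_op p (f + g) = alg_op p f + alg_op p g"
  by (simp add: alg_op_def lin_ext_def word_op_add smult_add_right sum.distrib)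

text \<open>With \<open>foldr\<close> the last letter acts first, so concatenation of words is
  composition of operators; linearity in both factors does the rest.\<close>

lemma alg_op_mult: "alg_op (p * q) f = alg_op p (alg_op q f)"
proof (induction p rule: free_alg_induct)
  case (single_add w c p)
  have "alg_op (Poly_Mapping.single w c * q) f = alg_op (Poly_Mapping.single w c) (alg_op q f)"
  proof (induction q rule: free_alg_induct)
    case zero
    have "foldr letter_op w (0 :: 'a poly) = 0"
      using word_op_smult[of w 0 0] by simp
    then show ?case by (simp add: alg_op_single alg_op.zero)
  next
    case (single_add v d q)
    then show ?case
      by (simp add: distrib_left alg_op.add mult_single alg_op_single plus_list_def
          word_op_add word_op_smult smult_add_right)
  qed
  with single_add show ?case
    by (simp add: distrib_right alg_op.add)
qed (simp add: alg_op.zero)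

lemma alg_op_weyl_ideal: "p \<in> weyl_ideal \<Longrightarrow> alg_op p f = 0"
\<comment> \<open>A right multiple \<open>p * r\<close> uses the induction hypothesis at
  \<open>alg_op r f\<close>, so \<open>f\<close> must vary.\<close>
proof (induction p arbitrary: f rule: weyl_ideal.induct)
  case generator
  show ?case
    by (simp add: alg_op.diff alg_op_mult mon_def alg_op_single pderiv_pCons
        flip: single_one zero_list_def) (simp add: zero_list_def pderiv_pCons)
next
  case (mult_left p r)
  then show ?case
    \<comment> \<open>Additivity at \<open>0 + 0\<close> gives
      \<open>alg_op r 0 = 0\<close>.\<close>
    using alg_op_add_right[of r 0 0] add_cancel_right_right[of "alg_op r 0" "alg_op r 0"]
    by (simp add: alg_op_mult)
qed (simp_all add: alg_op.zero alg_op.add alg_op_mult)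

lift_definition weyl_poly :: "'k::field weyl \<Rightarrow> 'k poly" is "\<lambda>p. alg_op p 1"
  using alg_op_weyl_ideal by (fastforce simp: weyl_rel_def alg_op.diff)

lemma linear_weyl_poly:
  "Vector_Spaces.linear weyl_scale smult (weyl_poly :: 'k::field weyl \<Rightarrow> _)"
proof -
  interpret W: vector_space "weyl_scale :: 'k \<Rightarrow> _" by (rule vector_space_weyl)
  show ?thesis
    by unfold_locales (transfer; simp add: alg_op.add alg_op.scale)+
qed

lemma weyl_poly_phi: "weyl_poly (phi w :: 'k::field weyl) = foldr letter_op w 1"
proof -
  have "(phi w :: 'k weyl) = abs_weyl (mon w)"
  proof (induction w)
    case Nil
    show ?case by (simp add: phi_Nil mon_Nil one_weyl_def)
  next
    case (Cons a w)
    have "(phi (a # w) :: 'k weyl) = weyl_gen a * phi w"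
      by (simp add: phi_def)
    also have "\<dots> = abs_weyl (mon [a] * mon w)"
      by (simp add: Cons.IH weyl_gen.abs_eq times_weyl.abs_eq)
    finally show ?case
      using arg_cong[OF mon_append[of "[a]" w], of "abs_weyl :: 'k free_alg \<Rightarrow> _"] by simp
  qed
  then show ?thesis
    by (simp add: weyl_poly.abs_eq mon_def alg_op_single)
qed

text \<open>The derivative has no term in degree \<open>degree f\<close>, so adding it preserves the
  leading term; multiplication by \<open>x\<close> only shifts it.\<close>

lemma monic_letter_op:
  assumes "lead_coeff f = 1"
  shows "lead_coeff (letter_op a f) = 1"
proof (cases a)
  case D
  have "coeff (pderiv f) (degree f) = 0"
    by (simp add: coeff_pderiv coeff_eq_0)
  moreover have "degree (f + pderiv f) \<le> degree f"
    by (intro degree_add_le) (auto intro!: degree_le simp: coeff_pderiv coeff_eq_0)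
  ultimately have "degree (f + pderiv f) = degree f"
    using assms le_degree[of "f + pderiv f" "degree f"] by simp
  with D show ?thesis
    using assms \<open>coeff (pderiv f) (degree f) = 0\<close> by simp
next
  case U
  with assms show ?thesis by (auto simp: degree_pCons_eq_if)
qed

lemma monic_weyl_poly_phi: "lead_coeff (weyl_poly (phi w :: 'k::field weyl)) = 1"
  unfolding weyl_poly_phi by (induction w) (simp_all add: monic_letter_op del: letter_op.simps)

theorem theorem10p1:
  fixes n :: nat
    and u v :: "nat \<Rightarrow> word"
  shows "pure_tensor weyl_scale {1..n} (\<lambda>i. phi (u i) :: 'k::field_char_0 weyl)
           = pure_tensor weyl_scale {1..n} (\<lambda>i. phi (v i))
         \<longleftrightarrow> (\<forall>i\<in>{1..n}. phi (u i) = (phi (v i) :: 'k weyl))"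
proof
  assume eq: "pure_tensor weyl_scale {1..n} (\<lambda>i. phi (u i) :: 'k weyl)
    = pure_tensor weyl_scale {1..n} (\<lambda>i. phi (v i))"
  interpret W: vector_space "weyl_scale :: 'k \<Rightarrow> _" by (rule vector_space_weyl)
  interpret P: Vector_Spaces.linear weyl_scale smult "weyl_poly :: 'k weyl \<Rightarrow> _"
    by (rule linear_weyl_poly)
  \<comment> \<open>Each functional reads the coefficient where the image of
    \<open>phi (u i)\<close> has its leading 1, so contracting the \<open>u\<close> side gives the
    scalar 1.\<close>
  define l :: "nat \<Rightarrow> 'k weyl \<Rightarrow> 'k"
    where "l i x = coeff (weyl_poly x) (degree (weyl_poly (phi (u i) :: 'k weyl)))" for i x
  have lin: "Vector_Spaces.linear weyl_scale (*) (l i)" for i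
    by unfold_locales (simp_all add: l_def P.add P.scale algebra_simps)
  have l_u: "l i (phi (u i)) = 1" for i
    by (simp add: l_def monic_weyl_poly_phi)
  show "\<forall>j\<in>{1..n}. phi (u j) = (phi (v j) :: 'k weyl)"
  proof
    fix j assume j: "j \<in> {1..n}"
    define c where "c = (\<Prod>i\<in>{1..n} - {j}. l i (phi (v i)))"
    have u_v: "phi (u j) = weyl_scale c (phi (v j))"
      using pure_tensor_eq_contract[OF vector_space_weyl eq finite_atLeastAtMost j, of l] lin
      by (simp add: l_u c_def)
    then have "lead_coeff (weyl_poly (phi (u j) :: 'k weyl))
        = lead_coeff (smult c (weyl_poly (phi (v j))))"
      by (simp only: P.scale)
    \<comment> \<open>Both images are monic, and \<open>lead_coeff\<close> commutes with
      \<open>smult c\<close> even at \<open>c = 0\<close>.\<close>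
    then have "c = 1"
      unfolding lead_coeff_smult monic_weyl_poly_phi by simp
    with u_v show "phi (u j) = (phi (v j) :: 'k weyl)" by simp
  qed
next
  assume "\<forall>i\<in>{1..n}. phi (u i) = (phi (v i) :: 'k weyl)"
  \<comment> \<open>A pure tensor sees its tuple only through the restriction to the index
    set.\<close>
  then have "restrict (\<lambda>i. phi (u i) :: 'k weyl) {1..n} = restrict (\<lambda>i. phi (v i)) {1..n}"
    by (intro restrict_ext) auto
  then show "pure_tensor weyl_scale {1..n} (\<lambda>i. phi (u i) :: 'k weyl)
      = pure_tensor weyl_scale {1..n} (\<lambda>i. phi (v i))"
    by (simp only: pure_tensor_def)
qed

end
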